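(* Let $N\ge 2$ be an integer and let $\chi$ be a non-principal Dirichlet character modulo $N$. For $\tau$ in the upper half-plane $\mathbb{H}$, the function $$z\mapsto h_N(z;\tau,\chi)=\int_{-\infty}^{\infty}\Phi_N(x;\chi)\,e^{\pi i\tau x^2-2\pi zx}\,dx$$ is an entire function of $z\in\mathbb{C}$. Moreover, if $\chi(-1)=-1$ then $h_N(z;\tau,\chi)$ is an even function of $z$, and if $\chi(-1)=1$ then $h_N(z;\tau,\chi)$ is an odd function of $z$.
   Context: A Dirichlet character modulo $N$ is a function $\chi:\mathbb{Z}\to\mathbb{C}$ with $\chi(1)=1$, $\chi(n+N)=\chi(n)$, $\chi(mn)=\chi(m)\chi(n)$, and $\chi(n)=0$ if and only if $\gcd(n,N)>1$; it is principal if $\chi(n)=1$ whenever $\gcd(n,N)=1$. Define $\phi_N(t;\chi)=\dfrac{\sum_{n=1}^{N-1}\chi(n)t^n}{1-t^N}$ and $\Phi_N(x;\chi)=\phi_N(e^{2\pi x/\sqrt N};\chi)$ for real $x$ (the singularity at $x=0$ is removable since $\sum_{n=1}^{N-1}\chi(n)=0$ for non-principal $\chi$). *)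

theory Defs
  imports "HOL-Complex_Analysis.Complex_Analysis"
begin

definition dirichlet_character :: "nat \<Rightarrow> (int \<Rightarrow> complex) \<Rightarrow> bool" where
  "dirichlet_character N chi \<longleftrightarrow>
     chi 1 = 1 \<and>
     (\<forall>n. chi (n + int N) = chi n) \<and>
     (\<forall>m n. chi (m * n) = chi m * chi n) \<and>
     (\<forall>n. chi n = 0 \<longleftrightarrow> gcd n (int N) > 1)"

definition principal_character :: "nat \<Rightarrow> (int \<Rightarrow> complex) \<Rightarrow> bool" where
  "principal_character N chi \<longleftrightarrow> (\<forall>n. gcd n (int N) = 1 \<longrightarrow> chi n = 1)"

definition phi_N :: "nat \<Rightarrow> (int \<Rightarrow> complex) \<Rightarrow> complex \<Rightarrow> complex" where
  "phi_N N chi t = (\<Sum>n = 1..N - 1. chi (int n) * t ^ n) / (1 - t ^ N)"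

text \<open>
  The value at \<open>0\<close> is the limit there, i.e. the removable singularity is filled in
  (the quotient itself would be \<open>0\<close> at that point by the convention on division by zero).
\<close>

definition Phi_N :: "nat \<Rightarrow> (int \<Rightarrow> complex) \<Rightarrow> real \<Rightarrow> complex" where
  "Phi_N N chi x =
     (let f = (\<lambda>y::real. phi_N N chi (exp (complex_of_real (2 * pi * y / sqrt (real N)))))
      in if x = 0 then Lim (at 0) f else f x)"

definition h_integrand ::
    "nat \<Rightarrow> (int \<Rightarrow> complex) \<Rightarrow> complex \<Rightarrow> complex \<Rightarrow> real \<Rightarrow> complex" where
  "h_integrand N chi \<tau> z x =
     Phi_N N chi x *
     exp (complex_of_real pi * \<i> * \<tau> * (complex_of_real x)\<^sup>2
          - 2 * complex_of_real pi * z * complex_of_real x)"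

definition h_N :: "nat \<Rightarrow> complex \<Rightarrow> complex \<Rightarrow> (int \<Rightarrow> complex) \<Rightarrow> complex" where
  "h_N N z \<tau> chi = (LINT x|lborel. h_integrand N chi \<tau> z x)"

end

theory Submission
  imports Defs "HOL-Probability.Distributions"
begin

text \<open>
  Since \<open>\<Sum>n<N. \<chi>(n) = 0\<close>, the factor \<open>1 - t\<close> cancels and
  \<open>\<phi>\<^sub>N(t) = - (\<Sum>n<N. \<chi>(n) \<cdot> (\<Sum>j<n. t\<^sup>j)) / (\<Sum>j<N. t\<^sup>j)\<close>, which is
  continuous for \<open>t > 0\<close> and bounded there by \<open>\<Sum>n<N. |\<chi>(n)|\<close>. So \<open>\<Phi>\<^sub>N\<close> is bounded and
  the Gaussian factor makes the integral converge together with its \<open>z\<close>-derivative; the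
  parity comes from \<open>\<phi>\<^sub>N(1/t) = -\<chi>(-1) \<phi>\<^sub>N(t)\<close> by substituting \<open>-x\<close> for \<open>x\<close>.
\<close>

section \<open>Two-sided Laplace transforms\<close>

text \<open>Differentiation under the integral by dominated convergence of the difference quotients.
  Having \<open>int\<close> for every \<open>a\<close> leaves room in the exponent for the factors
  that the difference quotient adds to \<open>exp (norm z * \<bar>x\<bar>)\<close>.\<close>

lemma holomorphic_two_sided_Laplace:
  fixes g :: "real \<Rightarrow> complex"
  assumes int: "\<And>a. integrable lborel (\<lambda>x. norm (g x) * exp (a * \<bar>x\<bar>))"
    and meas: "g \<in> borel_measurable borel"
  shows "integrable lborel (\<lambda>x. g x * exp (z * complex_of_real x))"
    and "(\<lambda>z. LINT x|lborel. g x * exp (z * complex_of_real x)) holomorphic_on UNIV"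
proof -
  note [measurable] = meas
  have exp_le: "exp (Re z * x) \<le> exp (norm z * \<bar>x\<bar>)" for z x
  proof -
    have "Re z * x \<le> \<bar>Re z\<bar> * \<bar>x\<bar>" by (metis abs_ge_self abs_mult)
    also have "\<dots> \<le> norm z * \<bar>x\<bar>" by (intro mult_right_mono abs_Re_le_cmod) auto
    finally show ?thesis by simp
  qed
  have int': "integrable lborel (\<lambda>x. g x * exp (z * complex_of_real x))" for z
    by (rule Bochner_Integration.integrable_bound[OF int[of "norm z"]])
       (auto simp: norm_mult intro!: mult_left_mono exp_le)
  show "integrable lborel (\<lambda>x. g x * exp (z * complex_of_real x))" by (rule int')
  define F where "F z = (LINT x|lborel. g x * exp (z * complex_of_real x))" for z
  have "(F has_field_derivative (LINT x|lborel. g x * (x * exp (z * complex_of_real x)))) (at z)" for z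
    \<comment> \<open>The limit is taken along sequences, since the dominated convergence theorem is
      stated for them.\<close>
    unfolding has_field_derivative_iff tendsto_at_iff_sequentially comp_def
  proof (intro allI impI)
    fix w assume w: "\<forall>i. w i \<in> UNIV - {z}" "w \<longlonglongrightarrow> z"
    define u where "u i = w i - z" for i
    have u0: "u i \<noteq> 0" for i using w by (auto simp: u_def)
    have u: "u \<longlonglongrightarrow> 0" using w(2) unfolding u_def by (simp add: LIM_zero)
    have "Bseq u" using u convergentI convergent_imp_Bseq by blast
    then obtain B where B: "\<And>i. norm (u i) \<le> B" by (auto simp: Bseq_def)
    have expl: "(exp (u i * x) - 1) / u i * exp (z * x) = (exp (w i * x) - exp (z * x)) / u i" for i x
      by (simp add: u_def algebra_simps diff_divide_distrib flip: exp_add)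
    have quot: "(F (w i) - F z) / (w i - z) =
        (LINT x|lborel. g x * ((exp (u i * complex_of_real x) - 1) / u i * exp (z * complex_of_real x)))" for i
      unfolding F_def Bochner_Integration.integral_diff[OF int' int', symmetric]
        integral_divide_zero[symmetric] expl
      by (simp add: u_def algebra_simps)
    show "(\<lambda>i. (F (w i) - F z) / (w i - z)) \<longlonglongrightarrow> (LINT x|lborel. g x * (x * exp (z * complex_of_real x)))"
      unfolding quot
    \<comment> \<open>In the exponent, \<open>norm z\<close> comes from \<open>exp (z * x)\<close>,
      \<open>B\<close> from the Taylor remainder with increments bounded by \<open>B\<close>, and
      \<open>1\<close> from \<open>\<bar>x\<bar> \<le> exp \<bar>x\<bar>\<close>.\<close>
    proof (rule integral_dominated_convergence[OF _ _ int[of "norm z + B + 1"]])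
      have "(\<lambda>i. (exp (u i * complex_of_real x) - 1) / u i) \<longlonglongrightarrow> complex_of_real x" for x
      proof -
        have "((\<lambda>h. exp (h * complex_of_real x)) has_field_derivative x) (at 0)"
          by (auto intro!: derivative_eq_intros)
        then have "((\<lambda>h. (exp (h * complex_of_real x) - 1) / h) \<longlongrightarrow> complex_of_real x) (at 0)"
          by (simp add: DERIV_def)
        then show ?thesis
          using u u0 by (auto simp: tendsto_at_iff_sequentially comp_def)
      qed
      then show "AE x in lborel. (\<lambda>i. g x * ((exp (u i * complex_of_real x) - 1) / u i * exp (z * complex_of_real x)))
          \<longlonglongrightarrow> g x * (x * exp (z * complex_of_real x))"
        by (intro always_eventually allI tendsto_intros)
      fix i
      have "norm ((exp (u i * complex_of_real x) - 1) / u i * exp (z * complex_of_real x))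
              \<le> exp ((norm z + B + 1) * \<bar>x\<bar>)" for x
      proof -
        \<comment> \<open>The Taylor remainder of order 0 contains a factor
          \<open>norm (u i)\<close>, which cancels the denominator.\<close>
        have "norm (exp (u i * complex_of_real x) - 1) \<le> exp \<bar>Re (u i * complex_of_real x)\<bar> * norm (u i * complex_of_real x)"
          using Taylor_exp[of "u i * complex_of_real x" 0] by simp
        also have "\<dots> \<le> exp (B * \<bar>x\<bar>) * norm (u i * complex_of_real x)"
          using abs_Re_le_cmod[of "u i"] B[of i]
          by (intro mult_right_mono) (auto simp: abs_mult intro!: mult_right_mono)
        finally have "norm ((exp (u i * complex_of_real x) - 1) / u i) \<le> exp (B * \<bar>x\<bar>) * \<bar>x\<bar>"
          using u0[of i] by (simp add: norm_divide norm_mult field_simps)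
        also have "\<dots> \<le> exp (B * \<bar>x\<bar>) * exp \<bar>x\<bar>"
          using exp_ge_add_one_self[of "\<bar>x\<bar>"] by (intro mult_left_mono; (linarith | simp))
        finally have "norm ((exp (u i * complex_of_real x) - 1) / u i) \<le> exp (B * \<bar>x\<bar>) * exp \<bar>x\<bar>" .
        then have "norm ((exp (u i * complex_of_real x) - 1) / u i) * norm (exp (z * complex_of_real x))
             \<le> (exp (B * \<bar>x\<bar>) * exp \<bar>x\<bar>) * exp (norm z * \<bar>x\<bar>)"
          using exp_le by (intro mult_mono) auto
        also have "\<dots> = exp ((norm z + B + 1) * \<bar>x\<bar>)"
          by (simp add: algebra_simps flip: exp_add)
        finally show ?thesis by (simp only: norm_mult)
      qed
      then show "AE x in lborel. norm (g x * ((exp (u i * complex_of_real x) - 1) / u i * exp (z * complex_of_real x)))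
          \<le> norm (g x) * exp ((norm z + B + 1) * \<bar>x\<bar>)"
        by (intro AE_I2) (simp only: norm_mult[of "g _"] mult_left_mono norm_ge_zero)
    qed auto
  qed
  then have "F holomorphic_on UNIV"
    by (auto simp: holomorphic_on_def field_differentiable_def)
  then show "(\<lambda>z. LINT x|lborel. g x * exp (z * complex_of_real x)) holomorphic_on UNIV"
    unfolding F_def .
qed

section \<open>Gaussian majorants\<close>

lemma integrable_gaussian:
  fixes c :: real
  assumes "c > 0"
  shows "integrable lborel (\<lambda>x. exp (- c * x\<^sup>2))"
proof -
  \<comment> \<open>The standard deviation for which the normal density has exponent
    \<open>- c * x^2\<close>.\<close>
  define s where "s = 1 / sqrt (2 * c)"
  have s: "s > 0" "2 * s\<^sup>2 = 1 / c" using assms by (auto simp: s_def power_divide)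
  have "integrable lborel (\<lambda>x. sqrt (2 * pi * s\<^sup>2) * normal_density 0 s x)"
    using s(1) by (intro integrable_mult_right integrable_normal_density) auto
  also have "(\<lambda>x. sqrt (2 * pi * s\<^sup>2) * normal_density 0 s x) = (\<lambda>x. exp (- c * x\<^sup>2))"
    using s by (auto simp: normal_density_def fun_eq_iff)
  finally show ?thesis .
qed

text \<open>Completing the square: half of the Gaussian decay absorbs the linear exponent at the
  cost of a constant factor, and the other half remains integrable.\<close>

lemma integrable_gaussian_exp_abs:
  fixes c a :: real
  assumes "c > 0"
  shows "integrable lborel (\<lambda>x. exp (- c * x\<^sup>2) * exp (a * \<bar>x\<bar>))"
proof (rule Bochner_Integration.integrable_bound)
  show "integrable lborel (\<lambda>x. exp (a\<^sup>2 / (2 * c)) * exp (- (c / 2) * x\<^sup>2))"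
    using assms by (intro integrable_mult_right integrable_gaussian) auto
  have "a * \<bar>x\<bar> - c * x\<^sup>2 \<le> a\<^sup>2 / (2 * c) - c / 2 * x\<^sup>2" for x
  proof -
    have "0 \<le> (a - c * \<bar>x\<bar>)\<^sup>2 / (2 * c)" using assms by simp
    also have "\<dots> = a\<^sup>2 / (2 * c) + c / 2 * x\<^sup>2 - a * \<bar>x\<bar>"
      using assms by (simp add: power2_diff field_simps power2_eq_square)
    finally show ?thesis by (simp add: field_simps)
  qed
  then show "AE x in lborel. norm (exp (- c * x\<^sup>2) * exp (a * \<bar>x\<bar>))
      \<le> norm (exp (a\<^sup>2 / (2 * c)) * exp (- (c / 2) * x\<^sup>2))"
    by (intro AE_I2) (simp add: algebra_simps flip: exp_add)
qed auto

section \<open>Dirichlet characters\<close>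

lemma dirichlet_character_mod:
  assumes "dirichlet_character N chi"
  shows "chi (n mod int N) = chi n"
proof -
  have per: "chi (n + int N) = chi n" for n
    using assms by (auto simp: dirichlet_character_def)
  have up: "chi (n + int k * int N) = chi n" for n k
  proof (induction k)
    case (Suc k)
    then show ?case using per[of "n + int k * int N"] by (simp add: algebra_simps)
  qed simp
  have "chi (n + k * int N) = chi n" for n k
    \<comment> \<open>For negative \<open>k\<close>, the shift by \<open>- k\<close> periods is
      applied at \<open>n + k * int N\<close> and leads back to \<open>n\<close>.\<close>
    using up[of n "nat k"] up[of "n + k * int N" "nat (- k)"] by (cases "k \<ge> 0") auto
  from this[of "n mod int N" "n div int N"] show ?thesis
    by (simp add: mult.commute)
qed

lemma dirichlet_character_zero:
  assumes "dirichlet_character N chi" "N \<ge> 2"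
  shows "chi 0 = 0"
  using assms by (auto simp: dirichlet_character_def)

text \<open>Multiplication by a unit \<open>a\<close> permutes the residues, so the sum
  \<open>S\<close> satisfies \<open>S = chi a * S\<close>; non-principality supplies an
  \<open>a\<close> with \<open>chi a \<noteq> 1\<close>.\<close>

lemma sum_nonprincipal_character:
  assumes "dirichlet_character N chi" "\<not> principal_character N chi" "N \<ge> 2"
  shows "(\<Sum>n = 1..N - 1. chi (int n)) = 0"
proof -
  obtain a where a: "coprime a (int N)" "chi a \<noteq> 1"
    using assms(2) by (auto simp: principal_character_def coprime_iff_gcd_eq_1)
  have inj: "inj_on (\<lambda>n. (a * n) mod int N) {0..<int N}"
  proof (rule inj_onI)
    fix x y assume xy: "x \<in> {0..<int N}" "y \<in> {0..<int N}" "(a * x) mod int N = (a * y) mod int N"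
    then have "int N dvd a * (x - y)" by (simp add: mod_eq_dvd_iff right_diff_distrib)
    then have "int N dvd x - y" using a(1) by (simp add: coprime_commute coprime_dvd_mult_right_iff)
    then show "x = y" using xy by (simp flip: mod_eq_dvd_iff)
  qed
  have "(\<lambda>n. (a * n) mod int N) ` {0..<int N} \<subseteq> {0..<int N}" using assms(3) by auto
  then have im: "(\<lambda>n. (a * n) mod int N) ` {0..<int N} = {0..<int N}"
    by (intro card_subset_eq) (auto simp: card_image[OF inj])
  have "(\<Sum>n\<in>{0..<int N}. chi n) = (\<Sum>n\<in>{0..<int N}. chi ((a * n) mod int N))"
    by (subst im[symmetric], subst sum.reindex[OF inj]) simp
  also have "\<dots> = chi a * (\<Sum>n\<in>{0..<int N}. chi n)"
    using assms(1) by (simp add: dirichlet_character_mod sum_distrib_left) (simp add: dirichlet_character_def)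
  finally have "(\<Sum>n\<in>{0..<int N}. chi n) = 0" using a(2) by auto
  also have "{0..<int N} = int ` {0..<N}" by (simp add: image_int_atLeastLessThan)
  also have "(\<Sum>n\<in>int ` {0..<N}. chi n) = (\<Sum>n = 0..<N. chi (int n))"
    by (simp add: sum.reindex)
  \<comment> \<open>The residue 0 drops out because \<open>chi 0 = 0\<close>.\<close>
  also have "\<dots> = (\<Sum>n = 1..N - 1. chi (int n))"
    using assms dirichlet_character_zero[OF assms(1,3)]
    by (intro sum.mono_neutral_right) (auto simp: not_less_eq_eq)
  finally show ?thesis .
qed

lemma dirichlet_character_reflect:
  assumes "dirichlet_character N chi"
  shows "chi (int N - n) = chi (-1) * chi n"
proof -
  have "chi (int N - n) = chi (-1 * n + int N)" by simp
  then show ?thesis using assms unfolding dirichlet_character_def by metis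
qed

section \<open>The rational function and its restriction to the positive axis\<close>

text \<open>Clearing \<open>t ^ N\<close> reverses the numerator through
  \<open>n \<mapsto> N - n\<close>, where \<open>chi\<close> picks up \<open>chi (-1)\<close>; the
  denominator changes sign. If \<open>t ^ N = 1\<close>, both sides are 0 by the convention for
  division by zero.\<close>

lemma phi_N_inverse:
  assumes "dirichlet_character N chi" "N \<ge> 2" "t \<noteq> 0"
  shows "phi_N N chi (inverse t) = - chi (-1) * phi_N N chi t"
proof -
  have "t ^ N * (\<Sum>n = 1..N - 1. chi (int n) * inverse t ^ n) = (\<Sum>n = 1..N - 1. chi (int n) * t ^ (N - n))"
    unfolding sum_distrib_left
    by (intro sum.cong) (use assms in \<open>auto simp: field_simps power_diff power_inverse\<close>)
  also have "\<dots> = (\<Sum>n = 1..N - 1. chi (int (N - n)) * t ^ n)"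
    by (rule sum.reindex_bij_witness[of _ "\<lambda>n. N - n" "\<lambda>n. N - n"]) auto
  also have "\<dots> = chi (-1) * (\<Sum>n = 1..N - 1. chi (int n) * t ^ n)"
    unfolding sum_distrib_left
    by (intro sum.cong) (auto simp: of_nat_diff dirichlet_character_reflect[OF assms(1)])
  finally have *: "t ^ N * (\<Sum>n = 1..N - 1. chi (int n) * inverse t ^ n)
      = chi (-1) * (\<Sum>n = 1..N - 1. chi (int n) * t ^ n)" .
  have "phi_N N chi (inverse t) = (t ^ N * (\<Sum>n = 1..N - 1. chi (int n) * inverse t ^ n)) / (t ^ N * (1 - inverse t ^ N))"
    using assms(3) by (simp add: phi_N_def)
  also have "t ^ N * (1 - inverse t ^ N) = - (1 - t ^ N)"
    using assms(3) by (simp add: algebra_simps power_inverse)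
  finally show ?thesis unfolding * by (simp only: phi_N_def divide_minus_right minus_divide_left times_divide_eq_right mult_minus_left)
qed

lemma phi_N_reduced:
  assumes "(\<Sum>n = 1..N - 1. chi (int n)) = 0" "t \<noteq> 1"
  shows "phi_N N chi t = - (\<Sum>n = 1..N - 1. chi (int n) * (\<Sum>j<n. t ^ j)) / (\<Sum>j<N. t ^ j)"
proof -
  \<comment> \<open>Subtracting the vanishing character sum makes every term divisible by
    \<open>1 - t\<close>.\<close>
  have "(\<Sum>n = 1..N - 1. chi (int n) * t ^ n) = (\<Sum>n = 1..N - 1. chi (int n) * (t ^ n - 1))"
    using assms(1) by (simp add: right_diff_distrib sum_subtractf)
  also have "\<dots> = (1 - t) * - (\<Sum>n = 1..N - 1. chi (int n) * (\<Sum>j<n. t ^ j))"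
    unfolding power_diff_1_eq sum_distrib_left sum_negf[symmetric]
    by (intro sum.cong) (auto simp: algebra_simps)
  finally have "phi_N N chi t = ((1 - t) * - (\<Sum>n = 1..N - 1. chi (int n) * (\<Sum>j<n. t ^ j))) / ((1 - t) * (\<Sum>j<N. t ^ j))"
    unfolding phi_N_def one_diff_power_eq by simp
  then show ?thesis using assms(2) by (simp only: mult_divide_mult_cancel_left_if) simp
qed

text \<open>For \<open>t > 0\<close> all powers are positive, so each shorter geometric sum is at
  most the full one in the denominator. The bound is uniform in \<open>t\<close> and includes
  \<open>t = 1\<close>.\<close>

lemma phi_N_reduced_real_bound:
  fixes t :: real
  assumes "t > 0" "N \<ge> 1"
  shows "norm (- (\<Sum>n = 1..N - 1. chi (int n) * (\<Sum>j<n. complex_of_real t ^ j)) / (\<Sum>j<N. complex_of_real t ^ j))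
     \<le> (\<Sum>n = 1..N - 1. norm (chi (int n)))"
proof -
  have pos: "(\<Sum>j<N. t ^ j) > 0" using assms by (intro sum_pos) (auto simp: lessThan_empty_iff)
  have nrm: "norm (\<Sum>j<n. complex_of_real t ^ j) = (\<Sum>j<n. t ^ j)" for n
  proof -
    have "(\<Sum>j<n. complex_of_real t ^ j) = complex_of_real (\<Sum>j<n. t ^ j)" by simp
    moreover have "(\<Sum>j<n. t ^ j) \<ge> 0" using assms by (intro sum_nonneg) auto
    ultimately show ?thesis by (metis norm_of_real abs_of_nonneg)
  qed
  have "norm (\<Sum>n = 1..N - 1. chi (int n) * (\<Sum>j<n. complex_of_real t ^ j))
      \<le> (\<Sum>n = 1..N - 1. norm (chi (int n)) * (\<Sum>j<N. t ^ j))"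
    using assms by (intro sum_norm_le) (auto simp: norm_mult nrm intro!: mult_left_mono sum_mono2)
  then show ?thesis using pos by (simp add: norm_divide nrm pos_divide_le_eq sum_distrib_right)
qed

text \<open>One formula for all real \<open>x\<close>: its denominator is a sum of positive terms,
  so it is continuous at 0 and its value there is the limit used in \<open>Phi_N\<close>.\<close>

lemma Phi_N_eq:
  assumes "(\<Sum>n = 1..N - 1. chi (int n)) = 0" "N \<ge> 1"
  defines "t \<equiv> \<lambda>x. complex_of_real (exp (2 * pi * x / sqrt (real N)))"
  shows "Phi_N N chi x = - (\<Sum>n = 1..N - 1. chi (int n) * (\<Sum>j<n. t x ^ j)) / (\<Sum>j<N. t x ^ j)"
proof -
  let ?R = "\<lambda>x. - (\<Sum>n = 1..N - 1. chi (int n) * (\<Sum>j<n. t x ^ j)) / (\<Sum>j<N. t x ^ j)"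
  let ?f = "\<lambda>y::real. phi_N N chi (exp (complex_of_real (2 * pi * y / sqrt (real N))))"
  have eq: "?f y = ?R y" if "y \<noteq> 0" for y
  proof -
    have "t y \<noteq> 1" using that assms(2) by (simp add: t_def)
    from phi_N_reduced[OF assms(1) this] show ?thesis by (simp only: t_def exp_of_real)
  qed
  have ev: "\<forall>\<^sub>F y in at 0. ?R y = ?f y"
    unfolding eventually_at_filter by (intro always_eventually allI impI) (rule eq[symmetric])
  have "Lim (at 0) ?f = ?R 0"
  proof (rule tendsto_Lim)
    have "isCont ?R 0" unfolding t_def using assms(2) by (intro continuous_intros) auto
    then have "(?R \<longlongrightarrow> ?R 0) (at 0)" by (simp add: isCont_def)
    then show "(?f \<longlongrightarrow> ?R 0) (at 0)"
      by (rule Lim_transform_eventually[OF _ ev])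
  qed simp
  then show ?thesis using eq[of x] by (auto simp: Phi_N_def Let_def)
qed

lemma Phi_N_measurable:
  assumes "(\<Sum>n = 1..N - 1. chi (int n)) = 0" "N \<ge> 1"
  shows "Phi_N N chi \<in> borel_measurable borel"
  unfolding Phi_N_eq[OF assms, abs_def] by measurable

lemma Phi_N_bound:
  assumes "(\<Sum>n = 1..N - 1. chi (int n)) = 0" "N \<ge> 1"
  shows "norm (Phi_N N chi x) \<le> (\<Sum>n = 1..N - 1. norm (chi (int n)))"
  unfolding Phi_N_eq[OF assms] using assms(2) by (intro phi_N_reduced_real_bound) auto

text \<open>Negating \<open>x\<close> inverts the exponential. The point 0, where
  \<open>Phi_N\<close> is a limit instead of the quotient, is set aside; it is a null set for the
  integral.\<close>

lemma Phi_N_minus: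
  assumes "dirichlet_character N chi" "N \<ge> 2" "x \<noteq> 0"
  shows "Phi_N N chi (- x) = - chi (-1) * Phi_N N chi x"
  using phi_N_inverse[OF assms(1,2), of "exp (complex_of_real (2 * pi * x / sqrt (real N)))"] assms(3)
  by (simp add: Phi_N_def exp_minus)

text \<open>Under \<open>x \<mapsto> - x\<close> together with \<open>z \<mapsto> - z\<close> the
  exponential factor is unchanged, so only the sign from \<open>Phi_N_minus\<close> remains.\<close>

lemma h_N_minus:
  assumes "dirichlet_character N chi" "N \<ge> 2"
    and meas: "Phi_N N chi \<in> borel_measurable borel"
  shows "h_N N (- z) \<tau> chi = - chi (-1) * h_N N z \<tau> chi"
proof -
  note [measurable] = meas
  have "h_N N (- z) \<tau> chi = (LINT x|lborel. h_integrand N chi \<tau> (- z) (- x))"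
    unfolding h_N_def using lborel_integral_real_affine[of "-1" _ 0] by simp
  also have "\<dots> = (LINT x|lborel. - chi (-1) * h_integrand N chi \<tau> z x)"
  proof (rule integral_cong_AE)
    show "AE x in lborel. h_integrand N chi \<tau> (- z) (- x) = - chi (-1) * h_integrand N chi \<tau> z x"
      using AE_lborel_singleton[of "0::real"]
      by eventually_elim (simp add: h_integrand_def Phi_N_minus[OF assms(1,2)])
  qed (simp_all add: h_integrand_def)
  also have "\<dots> = - chi (-1) * h_N N z \<tau> chi" unfolding h_N_def by (rule integral_mult_right_zero)
  finally show ?thesis .
qed

theorem theorem1p2:
  fixes N :: nat and chi :: "int \<Rightarrow> complex" and \<tau> :: complex
  assumes "N \<ge> 2"
    and "dirichlet_character N chi"
    and "\<not> principal_character N chi"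
    and "Im \<tau> > 0"
  shows "(\<forall>z. integrable lborel (h_integrand N chi \<tau> z))
       \<and> (\<lambda>z. h_N N z \<tau> chi) holomorphic_on UNIV
       \<and> (chi (-1) = -1 \<longrightarrow> (\<forall>z. h_N N (-z) \<tau> chi = h_N N z \<tau> chi))
       \<and> (chi (-1) = 1 \<longrightarrow> (\<forall>z. h_N N (-z) \<tau> chi = - h_N N z \<tau> chi))"
proof -
  have N: "N \<ge> 1" using assms(1) by simp
  have sum0: "(\<Sum>n = 1..N - 1. chi (int n)) = 0"
    using sum_nonprincipal_character assms by blast
  note meas [measurable] = Phi_N_measurable[OF sum0 N]
  define C where "C = (\<Sum>n = 1..N - 1. norm (chi (int n)))"
  \<comment> \<open>The part of the integrand free of \<open>z\<close>: \<open>h_N\<close> is the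
    Laplace transform of \<open>g\<close> at \<open>- 2 * pi * z\<close>.\<close>
  define g where "g x = Phi_N N chi x * exp (complex_of_real pi * \<i> * \<tau> * (complex_of_real x)\<^sup>2)" for x
  have g_meas [measurable]: "g \<in> borel_measurable borel" unfolding g_def by measurable
  have "C \<ge> 0" unfolding C_def by (intro sum_nonneg) auto
  \<comment> \<open>The modulus of the quadratic exponential depends only on
    \<open>Im \<tau>\<close>, whose positivity gives Gaussian decay.\<close>
  have g_bound: "norm (g x) \<le> C * exp (- (pi * Im \<tau>) * x\<^sup>2)" for x
    using Phi_N_bound[OF sum0 N, of x]
    by (auto simp: g_def C_def norm_mult intro!: mult_right_mono simp flip: of_real_power)
  have g_int: "integrable lborel (\<lambda>x. norm (g x) * exp (a * \<bar>x\<bar>))" for a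
  proof (rule Bochner_Integration.integrable_bound)
    show "integrable lborel (\<lambda>x. C * (exp (- (pi * Im \<tau>) * x\<^sup>2) * exp (a * \<bar>x\<bar>)))"
      using assms(4) by (intro integrable_mult_right integrable_gaussian_exp_abs) auto
    show "AE x in lborel. norm (norm (g x) * exp (a * \<bar>x\<bar>))
        \<le> norm (C * (exp (- (pi * Im \<tau>) * x\<^sup>2) * exp (a * \<bar>x\<bar>)))"
      using g_bound \<open>C \<ge> 0\<close> by (auto simp: abs_mult simp flip: mult.assoc)
  qed auto
  have h_eq: "h_integrand N chi \<tau> z = (\<lambda>x. g x * exp ((- 2 * complex_of_real pi * z) * complex_of_real x))" for z
    by (auto simp: fun_eq_iff h_integrand_def g_def mult.assoc simp flip: exp_add)
  note laplace = holomorphic_two_sided_Laplace[OF g_int g_meas]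
  have "(\<lambda>z. h_N N z \<tau> chi) holomorphic_on UNIV"
    unfolding h_N_def h_eq
    by (rule holomorphic_on_compose[OF _ holomorphic_on_subset[OF laplace(2)],
          of "\<lambda>z. - 2 * complex_of_real pi * z", unfolded comp_def])
       (auto intro!: holomorphic_intros)
  moreover have "integrable lborel (h_integrand N chi \<tau> z)" for z
    unfolding h_eq by (rule laplace(1))
  ultimately show ?thesis
    \<comment> \<open>The factor \<open>- chi (-1)\<close> is 1 for an odd character and -1 for an
      even one, so the parity of \<open>h_N\<close> is opposite to that of
      \<open>chi\<close>.\<close>
    using h_N_minus[OF assms(2,1) meas] by simp
qed

end
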